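(* Let $p\in(1,\infty)\setminus\{2\}$, let $n\ge 2$, and let $L\ne\{0\}$ be a linear subspace of $\ell_p^n=(\mathbb{R}^n,\|\cdot\|_p)$. The metric projection $P_L$ is linear if and only if $L$ is of the form \[ \bigoplus_{k=1}^d\mathbb{R}\,(e_{i_k}+\lambda_k e_{j_k}) \] with $d\in\{1,\dots,n\}$, $i_k,j_k\in\{1,\dots,n\}$ and $\lambda_k\in\mathbb{R}$ for $k=1,\dots,d$. In other words, $P_L$ is linear if and only if $L$ is spanned by vectors with at most two nonzero entries.
   Context: $\|x\|_p=\left(\sum_{i=1}^n|x_i|^p\right)^{1/p}$, and $e_1,\dots,e_n$ denotes the standard basis of $\mathbb{R}^n$. The metric projection $P_L\colon\ell_p^n\to\ell_p^n$ sends $x$ to the unique point $P_Lx\in L$ with $\|x-P_Lx\|_p=\min_{y\in L}\|x-y\|_p$. *)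

theory Defs
  imports "HOL-Analysis.Analysis"
begin

definition pnorm :: "real \<Rightarrow> real ^ 'n \<Rightarrow> real" where
  "pnorm p x = (\<Sum>i\<in>UNIV. \<bar>x $ i\<bar> powr p) powr (1 / p)"

(* Meaningful when the nearest point exists and is unique; for 1 < p and L a linear
   subspace this always holds (L is closed, pnorm p is a strictly convex norm). *)
definition metric_proj :: "real \<Rightarrow> (real ^ 'n) set \<Rightarrow> real ^ 'n \<Rightarrow> real ^ 'n" where
  "metric_proj p L x =
     (THE y. y \<in> L \<and> (\<forall>z\<in>L. pnorm p (x - y) \<le> pnorm p (x - z)))"

(* L is the internal direct sum of the linear subspaces V k, k in the finite set I:
   the sum of the V k is L, and 0 decomposes only trivially.  Summands {0} are allowed. *)
definition internal_direct_sum ::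
    "'a::real_vector set \<Rightarrow> 'k set \<Rightarrow> ('k \<Rightarrow> 'a set) \<Rightarrow> bool" where
  "internal_direct_sum L I V \<longleftrightarrow>
     L = {\<Sum>k\<in>I. v k | v. \<forall>k\<in>I. v k \<in> V k} \<and>
     (\<forall>v. (\<forall>k\<in>I. v k \<in> V k) \<and> (\<Sum>k\<in>I. v k) = 0 \<longrightarrow> (\<forall>k\<in>I. v k = 0))"

end

theory Submission imports Defs
begin

text \<open>
  Write \<open>\<phi> t = sgn t * \<bar>t\<bar> powr (p - 1)\<close>, applied to vectors
  entrywise (\<open>duality_map\<close> below).  Up to a factor it is the gradient of \<open>\<Sum>i. \<bar>x $ i\<bar> powr p\<close>,
  which is convex, so \<open>y\<close> is nearest to \<open>x\<close> in \<open>L\<close> exactly when \<open>y \<in> L\<close> and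
  \<open>\<phi> (x - y)\<close> is orthogonal to \<open>L\<close>.  Consequently the projection is linear if and only if its
  kernel, the preimage of the orthogonal complement \<open>M\<close> of \<open>L\<close> under \<open>\<phi>\<close>, is closed under
  addition (\<open>linear_metric_proj_iff\<close>).

  Suppose \<open>L\<close> is spanned by vectors with at most two nonzero entries.  Then \<open>M\<close> is cut out by
  equations of the form \<open>a * y $ i + b * y $ j = 0\<close>.  As \<open>\<phi>\<close> is odd, multiplicative and
  injective on the reals, replacing \<open>y\<close> by \<open>\<phi> x\<close> turns each of them into a linear equation
  for \<open>x\<close>, so the kernel is a subspace.

  Suppose conversely that the kernel is closed under addition.  Choose a smallest set \<open>B\<close> of
  coordinates such that \<open>L\<close> together with the coordinate vectors of \<open>B\<close> spans the whole space.
  Then the elements of \<open>M\<close> are parametrised by their entries in \<open>B\<close>, and \<open>L\<close> is spanned by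
  vectors \<open>r i\<close>, one for each \<open>i \<notin> B\<close>, whose only entry outside \<open>B\<close> is a \<open>1\<close> at \<open>i\<close>
  (this is an echelon form).  If some \<open>r i\<close> had two nonzero entries in \<open>B\<close>, there would be two
  elements of \<open>M\<close> which restricted to \<open>B\<close> have disjoint supports, and which both have entry
  \<open>1\<close> at \<open>i\<close>.  Adding their preimages under \<open>\<phi>\<close> and mapping the sum back yields an element
  of \<open>M\<close>; disjointness of the supports makes it agree on \<open>B\<close>, hence everywhere, with the
  sum of the two.  Comparing the entries at \<open>i\<close> gives \<open>2 powr (p - 1) = 2\<close>, that is,
  \<open>p = 2\<close>.
\<close>

section \<open>Signed powers\<close>

definition signed_powr :: "real \<Rightarrow> real \<Rightarrow> real" where
  "signed_powr r t = sgn t * \<bar>t\<bar> powr r"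

lemma signed_powr_0 [simp]: "signed_powr r 0 = 0"
  by (simp add: signed_powr_def)

lemma signed_powr_1 [simp]: "signed_powr r 1 = 1"
  by (simp add: signed_powr_def)

lemma signed_powr_minus: "signed_powr r (- t) = - signed_powr r t"
  by (simp add: signed_powr_def sgn_minus)

lemma signed_powr_mult: "signed_powr r (s * t) = signed_powr r s * signed_powr r t"
  by (simp add: signed_powr_def sgn_mult abs_mult powr_mult)

lemma signed_powr_signed_powr:
  "signed_powr r (signed_powr s t) = signed_powr (s * r) t"
  by (cases "t = 0")
     (auto simp: signed_powr_def sgn_mult abs_mult powr_powr abs_sgn_eq)

lemma signed_powr_one: "signed_powr 1 t = t"
  by (simp add: signed_powr_def sgn_mult_abs)

lemma signed_powr_inverse:
  assumes "r > 0"
  shows "signed_powr r (signed_powr (1 / r) t) = t"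
    and "signed_powr (1 / r) (signed_powr r t) = t"
  using assms by (simp_all add: signed_powr_signed_powr signed_powr_one)

lemma signed_powr_strict_mono:
  assumes "r > 0" "s < t"
  shows "signed_powr r s < signed_powr r t"
proof -
  consider "s \<ge> 0" | "t \<le> 0" | "s < 0" "t > 0" by linarith
  then show ?thesis
  proof cases
    case 1
    then have "s powr r < t powr r"
      using assms by (intro powr_less_mono2) auto
    with 1 assms show ?thesis by (cases "s = 0") (auto simp: signed_powr_def)
  next
    case 2
    then have "(- t) powr r < (- s) powr r"
      using assms by (intro powr_less_mono2) auto
    with 2 assms show ?thesis by (cases "t = 0") (auto simp: signed_powr_def)
  next
    case 3
    then have "- (\<bar>s\<bar> powr r) < 0" "0 < t powr r" by simp_all
    then have "- (\<bar>s\<bar> powr r) < t powr r" by (rule less_trans)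
    with 3 show ?thesis by (simp add: signed_powr_def)
  qed
qed

lemma signed_powr_continuous:
  assumes "r > 0"
  shows "continuous_on UNIV (signed_powr r)"
proof -
  have eq: "signed_powr r = (\<lambda>t. max t 0 powr r - max (- t) 0 powr r)"
    by (auto simp: signed_powr_def fun_eq_iff sgn_if max_def)
  show ?thesis
    unfolding eq using assms
    by (intro continuous_on_diff continuous_on_powr' continuous_intros) auto
qed

text \<open>
  The graph of \<open>\<lambda>t. \<bar>t\<bar> powr p\<close> lies above its tangent at \<open>a\<close>.  After multiplying out, this is
  Young's inequality for the product of \<open>\<bar>b\<bar>\<close> and \<open>\<bar>a\<bar> powr (p - 1)\<close>.
\<close>
lemma abs_powr_above_tangent:
  fixes a b p :: real
  assumes "1 < p"
  shows "\<bar>a\<bar> powr p + p * signed_powr (p - 1) a * (b - a) \<le> \<bar>b\<bar> powr p"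
proof -
  define q where "q = p / (p - 1)"
  have q: "q > 1" "1 / p + 1 / q = 1" "(p - 1) * q = p"
    using assms by (auto simp: q_def field_simps)
  have young: "\<bar>b\<bar> * \<bar>a\<bar> powr (p - 1) \<le> \<bar>b\<bar> powr p / p + (\<bar>a\<bar> powr (p - 1)) powr q / q"
    using assms q by (intro Youngs_inequality) auto
  have pq: "p / q = p - 1"
    using assms by (auto simp: q_def field_simps)
  have "signed_powr (p - 1) a * b \<le> \<bar>signed_powr (p - 1) a * b\<bar>" by simp
  also have "\<dots> \<le> \<bar>b\<bar> * \<bar>a\<bar> powr (p - 1)"
    by (auto simp: signed_powr_def abs_mult abs_sgn_eq)
  also note young
  also have "(\<bar>a\<bar> powr (p - 1)) powr q = \<bar>a\<bar> powr p"
    by (simp add: powr_powr q)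
  finally have "p * (signed_powr (p - 1) a * b) \<le> p * (\<bar>b\<bar> powr p / p + \<bar>a\<bar> powr p / q)"
    using assms by (intro mult_left_mono) auto
  also have "\<dots> = \<bar>b\<bar> powr p + (p / q) * \<bar>a\<bar> powr p"
    using assms by (simp add: field_simps)
  finally have 1: "p * (signed_powr (p - 1) a * b) \<le> \<bar>b\<bar> powr p + (p - 1) * \<bar>a\<bar> powr p"
    by (simp add: pq)
  have "signed_powr (p - 1) a * a = \<bar>a\<bar> * \<bar>a\<bar> powr (p - 1)"
    by (simp add: signed_powr_def abs_sgn mult_ac)
  also have "\<dots> = \<bar>a\<bar> powr p"
    by (simp add: powr_mult_base)
  finally have 2: "signed_powr (p - 1) a * a = \<bar>a\<bar> powr p" .
  have "p * signed_powr (p - 1) a * (b - a)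
      = p * (signed_powr (p - 1) a * b) - p * (signed_powr (p - 1) a * a)"
    by (simp add: algebra_simps)
  with 1 2 show ?thesis by (simp add: algebra_simps)
qed

section \<open>Nearest points\<close>

definition duality_map :: "real \<Rightarrow> real ^ 'n \<Rightarrow> real ^ 'n" where
  "duality_map p x = (\<chi> i. signed_powr (p - 1) (x $ i))"

text \<open>
  The points whose nearest point in \<open>L\<close> is \<open>0\<close>, described by the first-order condition
  (see \<open>metric_proj_eq_iff\<close>).
\<close>
definition dual_annihilator :: "real \<Rightarrow> (real ^ 'n) set \<Rightarrow> (real ^ 'n) set" where
  "dual_annihilator p L = {x. \<forall>l\<in>L. duality_map p x \<bullet> l = 0}"

lemma inner_vec_sum: "(x :: real ^ 'n) \<bullet> y = (\<Sum>i\<in>UNIV. x $ i * y $ i)"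
  by (simp add: inner_vec_def)

lemma duality_map_scaleR:
  "duality_map p (c *\<^sub>R x) = signed_powr (p - 1) c *\<^sub>R duality_map p x"
  by (simp add: duality_map_def vec_eq_iff signed_powr_mult)

lemma continuous_duality_map:
  assumes "1 < p"
  shows "continuous_on UNIV (duality_map p :: real ^ 'n \<Rightarrow> real ^ 'n)"
proof -
  have "continuous_on UNIV (\<lambda>x :: real ^ 'n. signed_powr (p - 1) (x $ i))" for i :: 'n
    using assms
    by (intro continuous_on_compose2[OF signed_powr_continuous] continuous_intros) auto
  then show ?thesis
    unfolding duality_map_def by (intro continuous_on_vec_lambda)
qed

lemma pnorm_le_iff:
  assumes "1 < p"
  shows "pnorm p x \<le> pnorm p y \<longleftrightarrow>
    (\<Sum>i\<in>UNIV. \<bar>x $ i\<bar> powr p) \<le> (\<Sum>i\<in>UNIV. \<bar>y $ i\<bar> powr p)"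
proof -
  have mono: "a powr (1 / p) \<le> b powr (1 / p) \<longleftrightarrow> a \<le> b" if "0 \<le> a" "0 \<le> b" for a b :: real
    using powr_mono2[of "1 / p" a b] powr_less_mono2[of "1 / p" b a] assms that
    by (cases "a \<le> b") (auto simp: not_le)
  show ?thesis
    unfolding pnorm_def by (rule mono) (auto intro: sum_nonneg)
qed

lemma abs_component_le_pnorm:
  assumes "1 < p"
  shows "\<bar>x $ i\<bar> \<le> pnorm p x"
proof -
  have "\<bar>x $ i\<bar> = (\<bar>x $ i\<bar> powr p) powr (1 / p)"
    using assms by (simp add: powr_powr)
  also have "\<dots> \<le> pnorm p x"
    unfolding pnorm_def using assms
    by (intro powr_mono2 member_le_sum) auto
  finally show ?thesis .
qed

lemma continuous_pnorm:
  assumes "1 < p"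
  shows "continuous_on UNIV (pnorm p)"
  unfolding pnorm_def using assms
  by (intro continuous_on_powr' continuous_intros) (auto intro: sum_nonneg)

lemma pnorm_above_tangent:
  assumes "1 < p"
  shows "(\<Sum>i\<in>UNIV. \<bar>x $ i\<bar> powr p) + p * (duality_map p x \<bullet> (y - x))
      \<le> (\<Sum>i\<in>UNIV. \<bar>y $ i\<bar> powr p)"
proof -
  have "(\<Sum>i\<in>UNIV. \<bar>x $ i\<bar> powr p) + p * (duality_map p x \<bullet> (y - x))
    = (\<Sum>i\<in>UNIV. \<bar>x $ i\<bar> powr p + p * signed_powr (p - 1) (x $ i) * (y $ i - x $ i))"
    by (simp add: inner_vec_sum duality_map_def sum.distrib sum_distrib_left mult.assoc)
  also have "\<dots> \<le> (\<Sum>i\<in>UNIV. \<bar>y $ i\<bar> powr p)"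
    by (intro sum_mono abs_powr_above_tangent assms)
  finally show ?thesis .
qed

text \<open>
  Taking the tangent at the perturbed point \<open>u + t *\<^sub>R z\<close> instead of at \<open>u\<close> gives a
  one-sided bound for every \<open>t > 0\<close>; continuity of the duality map then takes the place of a
  derivative as \<open>t\<close> tends to \<open>0\<close>.
\<close>
lemma minimal_imp_dual_annihilator:
  assumes p: "1 < p" and L: "subspace L"
    and min: "\<And>z. z \<in> L \<Longrightarrow> pnorm p u \<le> pnorm p (u + z)"
  shows "u \<in> dual_annihilator p L"
proof -
  have ge0: "duality_map p u \<bullet> z \<ge> 0" if z: "z \<in> L" for z
  proof -
    have pos: "duality_map p (u + t *\<^sub>R z) \<bullet> z \<ge> 0" if t: "t > 0" for t
    proof -
      have "pnorm p u \<le> pnorm p (u + t *\<^sub>R z)"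
        using min L z by (simp add: subspace_scale)
      moreover have "u - (u + t *\<^sub>R z) = - t *\<^sub>R z" by simp
      ultimately have "0 \<le> p * (t * (duality_map p (u + t *\<^sub>R z) \<bullet> z))"
        using pnorm_above_tangent[OF p, of "u + t *\<^sub>R z" u]
        by (simp add: pnorm_le_iff[OF p])
      with p t show ?thesis by (simp add: zero_le_mult_iff)
    qed
    have cont: "continuous_on UNIV (\<lambda>t. duality_map p (u + t *\<^sub>R z) \<bullet> z)"
      by (intro continuous_on_compose2[OF continuous_duality_map[OF p]] continuous_intros) auto
    then have "((\<lambda>t. duality_map p (u + t *\<^sub>R z) \<bullet> z)
        \<longlongrightarrow> duality_map p (u + 0 *\<^sub>R z) \<bullet> z) (at 0)"
      by (intro isContD) (simp add: continuous_on_eq_continuous_at)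
    then have "((\<lambda>t. duality_map p (u + t *\<^sub>R z) \<bullet> z)
        \<longlongrightarrow> duality_map p (u + 0 *\<^sub>R z) \<bullet> z) (at_right 0)"
      by (rule filterlim_mono) (auto simp: at_within_le_at)
    then have "duality_map p (u + 0 *\<^sub>R z) \<bullet> z \<ge> 0"
      by (rule tendsto_lowerbound)
         (auto intro!: pos eventually_mono[OF eventually_at_right_less])
    then show ?thesis by simp
  qed
  have "duality_map p u \<bullet> z = 0" if "z \<in> L" for z
    using ge0[OF that] ge0[of "- z"] L that by (auto simp: subspace_neg)
  then show ?thesis by (simp add: dual_annihilator_def)
qed

text \<open>
  Uniqueness is strict monotonicity of the duality map: if \<open>u - v\<close> lies in \<open>L\<close>, it is
  orthogonal to \<open>duality_map p u - duality_map p v\<close>, although all the products of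
  corresponding entries are nonnegative.
\<close>
lemma dual_annihilator_unique:
  assumes p: "1 < p"
    and u: "u \<in> dual_annihilator p L" and v: "v \<in> dual_annihilator p L"
    and uv: "u - v \<in> L"
  shows "u = v"
proof -
  let ?f = "signed_powr (p - 1)"
  have pos: "(?f a - ?f b) * (a - b) > 0" if "a \<noteq> b" for a b
  proof (cases "a < b")
    case True
    then show ?thesis
      using signed_powr_strict_mono[of "p - 1" a b] p by (simp add: mult_neg_neg)
  next
    case False
    with that show ?thesis
      using signed_powr_strict_mono[of "p - 1" b a] p by simp
  qed
  have "(duality_map p u - duality_map p v) \<bullet> (u - v) = 0"
    using u v uv by (simp add: dual_annihilator_def inner_diff_left)
  then have sum0: "(\<Sum>i\<in>UNIV. (?f (u $ i) - ?f (v $ i)) * (u $ i - v $ i)) = 0"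
    by (simp add: inner_vec_sum duality_map_def)
  have nonneg: "(?f a - ?f b) * (a - b) \<ge> 0" for a b
    using pos[of a b] by (cases "a = b") auto
  have "(?f (u $ i) - ?f (v $ i)) * (u $ i - v $ i) = 0" for i
    using sum0 nonneg by (subst (asm) sum_nonneg_eq_0_iff) auto
  then have "u $ i = v $ i" for i
    using pos[of "u $ i" "v $ i"] by (metis less_irrefl)
  then show ?thesis by (simp add: vec_eq_iff)
qed

text \<open>
  A competitor that differs from \<open>x\<close> in some entry by more than \<open>pnorm p x\<close> is worse than
  \<open>0 \<in> L\<close>, so the minimum may be sought over a compact part of \<open>L\<close>.
\<close>
lemma nearest_point_exists:
  fixes L :: "(real ^ 'n) set"
  assumes p: "1 < p" and L: "subspace L"
  shows "\<exists>y\<in>L. \<forall>z\<in>L. pnorm p (x - y) \<le> pnorm p (x - z)"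
proof -
  define C where "C = pnorm p x"
  define K where "K = L \<inter> cbox (x - (\<chi> i. C)) (x + (\<chi> i. C))"
  have K_iff: "z \<in> K \<longleftrightarrow> z \<in> L \<and> (\<forall>i. \<bar>(x - z) $ i\<bar> \<le> C)" for z
    by (auto simp: K_def mem_box_cart abs_le_iff algebra_simps)
  have "compact K"
    unfolding K_def using closed_subspace[OF L] by (intro closed_Int_compact compact_cbox)
  moreover have K0: "0 \<in> K"
    using L abs_component_le_pnorm[OF p, of x] by (auto simp: K_iff C_def subspace_0)
  moreover have "continuous_on K (\<lambda>z. pnorm p (x - z))"
    by (intro continuous_on_compose2[OF continuous_pnorm[OF p]] continuous_intros) auto
  ultimately obtain y where y: "y \<in> K" "\<And>z. z \<in> K \<Longrightarrow> pnorm p (x - y) \<le> pnorm p (x - z)"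
    using continuous_attains_inf[of K "\<lambda>z. pnorm p (x - z)"] by auto
  have "pnorm p (x - y) \<le> pnorm p (x - z)" if "z \<in> L" for z
  proof (cases "z \<in> K")
    case False
    with that obtain i where "C < \<bar>(x - z) $ i\<bar>"
      by (auto simp: K_iff not_le)
    also have "\<dots> \<le> pnorm p (x - z)" by (rule abs_component_le_pnorm[OF p])
    finally show ?thesis using y(2)[OF K0] by (simp add: C_def)
  qed (use y in auto)
  then show ?thesis using y K_iff by blast
qed

lemma metric_proj_eq_iff:
  assumes p: "1 < p" and L: "subspace L"
  shows "metric_proj p L x = y \<longleftrightarrow> y \<in> L \<and> x - y \<in> dual_annihilator p L"
proof -
  let ?min = "\<lambda>y. y \<in> L \<and> (\<forall>z\<in>L. pnorm p (x - y) \<le> pnorm p (x - z))"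
  have min_imp: "x - y \<in> dual_annihilator p L" if "?min y" for y
  proof (rule minimal_imp_dual_annihilator[OF p L])
    fix z assume "z \<in> L"
    then have "y - z \<in> L" using that L by (simp add: subspace_diff)
    then have "pnorm p (x - y) \<le> pnorm p (x - (y - z))" using that by blast
    then show "pnorm p (x - y) \<le> pnorm p (x - y + z)" by (simp add: algebra_simps)
  qed
  have uniq: "y = y'"
    if "y \<in> L" "x - y \<in> dual_annihilator p L" "y' \<in> L" "x - y' \<in> dual_annihilator p L" for y y'
  proof -
    have "x - y - (x - y') \<in> L" using that L by (simp add: subspace_diff)
    from dual_annihilator_unique[OF p that(2,4) this] show ?thesis by simp
  qed
  obtain y0 where y0: "?min y0" using nearest_point_exists[OF p L] by blast
  have "metric_proj p L x = y0"
    unfolding metric_proj_def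
  proof (rule the_equality)
    show "?min y0" by (rule y0)
    show "y = y0" if "?min y" for y
      using uniq[of y y0] min_imp[OF that] min_imp[OF y0] that y0 by simp
  qed
  then show ?thesis
    using uniq[of y0 y] min_imp[OF y0] y0 by auto
qed

text \<open>
  Homogeneity is automatic, because the duality map takes multiples of a vector to multiples of
  its image; additivity is inherited from the kernel through the decomposition of each \<open>x\<close>
  into \<open>metric_proj p L x\<close> and a kernel element.
\<close>
lemma linear_metric_proj_iff:
  assumes p: "1 < p" and L: "subspace L"
  shows "linear (metric_proj p L) \<longleftrightarrow>
    (\<forall>x\<in>dual_annihilator p L. \<forall>y\<in>dual_annihilator p L. x + y \<in> dual_annihilator p L)"
    (is "?lin \<longleftrightarrow> ?add")
proof
  assume lin: ?lin
  have "x \<in> dual_annihilator p L \<longleftrightarrow> metric_proj p L x = 0" for x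
    using L by (simp add: metric_proj_eq_iff[OF p L] subspace_0)
  with lin show ?add by (simp add: linear_add)
next
  assume add: ?add
  let ?P = "metric_proj p L"
  have P: "?P x \<in> L" "x - ?P x \<in> dual_annihilator p L" for x
    using metric_proj_eq_iff[OF p L, of x "?P x"] by simp_all
  show ?lin
  proof (rule linearI)
    fix x y
    have "(x - ?P x) + (y - ?P y) \<in> dual_annihilator p L" using add P by blast
    moreover have "(x - ?P x) + (y - ?P y) = (x + y) - (?P x + ?P y)" by simp
    ultimately show "?P (x + y) = ?P x + ?P y"
      using P L by (auto simp: metric_proj_eq_iff[OF p L] subspace_add)
  next
    fix c x
    have "c *\<^sub>R (x - ?P x) \<in> dual_annihilator p L"
      using P(2)[of x] by (simp add: dual_annihilator_def duality_map_scaleR)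
    then show "?P (c *\<^sub>R x) = c *\<^sub>R ?P x"
      using P L by (auto simp: metric_proj_eq_iff[OF p L] subspace_scale scaleR_diff_right)
  qed
qed

section \<open>Spans of vectors with two nonzero entries\<close>

lemma two_sparse_decompose:
  fixes v :: "real ^ 'n"
  assumes "card {m. v $ m \<noteq> 0} \<le> 2"
  obtains i j a b where "v = a *\<^sub>R axis i 1 + b *\<^sub>R axis j 1"
proof -
  have *: "\<exists>a b. v = a *\<^sub>R axis i 1 + b *\<^sub>R axis j 1" if "{m. v $ m \<noteq> 0} \<subseteq> {i, j}" for i j
  proof -
    have "v = v $ i *\<^sub>R axis i 1 + (if i = j then 0 else v $ j) *\<^sub>R axis j 1"
      using that by (auto simp: vec_eq_iff axis_def)
    then show ?thesis by blast
  qed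
  consider "card {m. v $ m \<noteq> 0} = 0" | "card {m. v $ m \<noteq> 0} = 1" | "card {m. v $ m \<noteq> 0} = 2"
    using assms by linarith
  then show thesis
  proof cases
    case 1
    then show thesis using *[of undefined undefined] that by auto
  next
    case 2
    then obtain i where "{m. v $ m \<noteq> 0} = {i}" by (auto simp: card_1_singleton_iff)
    then show thesis using *[of i i] that by auto
  next
    case 3
    then obtain i j where "{m. v $ m \<noteq> 0} = {i, j}" by (auto simp: card_2_iff)
    then show thesis using *[of i j] that by auto
  qed
qed

text \<open>
  \<open>a * \<phi> s + b * \<phi> t = 0\<close> says that \<open>\<phi> (\<alpha> * s) = \<phi> (- (\<beta> * t))\<close>, where \<open>\<alpha>\<close> and \<open>\<beta>\<close> are the
  preimages of \<open>a\<close> and \<open>b\<close> under the signed power \<open>\<phi>\<close>; injectivity removes \<open>\<phi>\<close>.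
\<close>
lemma two_sparse_orthogonality_linear:
  fixes v :: "real ^ 'n"
  assumes p: "1 < p" and v: "card {m. v $ m \<noteq> 0} \<le> 2"
  obtains w where "\<And>x. duality_map p x \<bullet> v = 0 \<longleftrightarrow> w \<bullet> x = 0"
proof -
  obtain i j a b where vab: "v = a *\<^sub>R axis i 1 + b *\<^sub>R axis j 1"
    using two_sparse_decompose[OF v] .
  let ?f = "signed_powr (p - 1)" and ?g = "signed_powr (1 / (p - 1))"
  have inj: "s = t" if "?f s = ?f t" for s t
    using signed_powr_strict_mono[of "p - 1" s t] signed_powr_strict_mono[of "p - 1" t s] p that
    by linarith
  have fg: "?f (?g t) = t" for t
    using p by (simp add: signed_powr_inverse)
  let ?w = "?g a *\<^sub>R axis i 1 + ?g b *\<^sub>R axis j 1"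
  have "duality_map p x \<bullet> v = 0 \<longleftrightarrow> ?w \<bullet> x = 0" for x
  proof -
    have "duality_map p x \<bullet> v = a * ?f (x $ i) + b * ?f (x $ j)"
      by (simp add: vab inner_add_right inner_axis duality_map_def)
    also have "\<dots> = ?f (?g a * x $ i) - ?f (- (?g b * x $ j))"
      by (simp add: signed_powr_minus signed_powr_mult fg)
    finally have "duality_map p x \<bullet> v = 0 \<longleftrightarrow> ?g a * x $ i = - (?g b * x $ j)"
      using inj by auto
    then show ?thesis by (auto simp: inner_add_left inner_axis' algebra_simps)
  qed
  then show thesis by (rule that)
qed

lemma two_sparse_span_imp_linear:
  assumes p: "1 < p" and S: "\<And>v. v \<in> S \<Longrightarrow> card {m. v $ m \<noteq> 0} \<le> 2"
  shows "linear (metric_proj p (span S))"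
proof -
  have span_iff: "x \<in> dual_annihilator p (span S) \<longleftrightarrow> (\<forall>v\<in>S. duality_map p x \<bullet> v = 0)" for x
  proof -
    have "duality_map p x \<bullet> l = 0" if "\<forall>v\<in>S. duality_map p x \<bullet> v = 0" "l \<in> span S" for l
      using orthogonal_to_span[OF that(2), of "duality_map p x"] that(1)
      by (simp add: orthogonal_def)
    then show ?thesis by (auto simp: dual_annihilator_def span_base)
  qed
  have "duality_map p (x + y) \<bullet> v = 0"
    if "v \<in> S" "duality_map p x \<bullet> v = 0" "duality_map p y \<bullet> v = 0" for x y v
  proof -
    obtain w where "\<And>x. duality_map p x \<bullet> v = 0 \<longleftrightarrow> w \<bullet> x = 0"
      using two_sparse_orthogonality_linear[OF p S[OF \<open>v \<in> S\<close>]] by blast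
    with that show ?thesis by (simp add: inner_add_right)
  qed
  then show ?thesis
    by (simp add: linear_metric_proj_iff[OF p subspace_span] span_iff)
qed

text \<open>
  Here \<open>r i\<close> is the row of a reduced echelon form of \<open>L\<close> with pivot \<open>i\<close>; the pivots form the
  complement of \<open>B\<close>, and \<open>r i = 0\<close> for \<open>i \<in> B\<close>.
\<close>
lemma echelon_form:
  fixes L :: "(real ^ 'n) set"
  assumes L: "subspace L"
  obtains B :: "'n set" and r :: "'n \<Rightarrow> real ^ 'n"
  where "\<And>i. r i \<in> L" and "\<And>i k. k \<notin> B \<Longrightarrow> r i $ k = (if k = i then 1 else 0)"
    and "\<And>i. i \<in> B \<Longrightarrow> r i = 0"
    and "\<And>l. l \<in> L \<Longrightarrow> l = (\<Sum>i\<in>UNIV. l $ i *\<^sub>R r i)"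
proof -
  \<comment> \<open>\<open>L\<close> together with the coordinate vectors of \<open>B\<close> spans everything:\<close>
  let ?cover = "\<lambda>B :: 'n set. \<forall>x. \<exists>l\<in>L. \<forall>k. k \<notin> B \<longrightarrow> l $ k = x $ k"
  have "?cover UNIV" using subspace_0[OF L] by auto
  then obtain B where B: "?cover B" and min: "\<And>B'. ?cover B' \<Longrightarrow> card B \<le> card B'"
    using ex_has_least_nat[of ?cover UNIV card] by blast
  have L_B_0: "l = 0" if l: "l \<in> L" "\<And>k. k \<notin> B \<Longrightarrow> l $ k = 0" for l
  proof (rule ccontr)
    assume "l \<noteq> 0"
    then obtain b where b: "l $ b \<noteq> 0" by (auto simp: vec_eq_iff)
    with l have "b \<in> B" by blast
    have "?cover (B - {b})"
    proof
      fix x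
      obtain l' where l': "l' \<in> L" "\<And>k. k \<notin> B \<Longrightarrow> l' $ k = x $ k" using B by blast
      let ?m = "l' + ((x $ b - l' $ b) / l $ b) *\<^sub>R l"
      have "?m \<in> L" using L l l' by (simp add: subspace_add subspace_scale)
      moreover have "?m $ k = x $ k" if "k \<notin> B - {b}" for k
        using that b l l' by (cases "k = b") auto
      ultimately show "\<exists>l\<in>L. \<forall>k. k \<notin> B - {b} \<longrightarrow> l $ k = x $ k" by blast
    qed
    from min[OF this] \<open>b \<in> B\<close> show False
      by (metis card_Diff1_less finite leD)
  qed
  have "\<forall>i. \<exists>l\<in>L. \<forall>k. k \<notin> B \<longrightarrow> l $ k = axis i 1 $ k" using B by blast
  then obtain r where r: "\<And>i. r i \<in> L" "\<And>i k. k \<notin> B \<Longrightarrow> r i $ k = axis i 1 $ k" by metis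
  have r': "r i $ k = (if k = i then 1 else 0)" if "k \<notin> B" for i k
    using r(2)[OF that] by (simp add: axis_def)
  show thesis
  proof (rule that[of r B])
    show "r i = 0" if "i \<in> B" for i
      using that r(1) r' by (intro L_B_0) auto
    show "l = (\<Sum>i\<in>UNIV. l $ i *\<^sub>R r i)" if "l \<in> L" for l
    proof -
      have "(\<Sum>i\<in>UNIV. l $ i *\<^sub>R r i) $ k = l $ k" if "k \<notin> B" for k
      proof -
        have "(\<Sum>i\<in>UNIV. l $ i *\<^sub>R r i) $ k = (\<Sum>i\<in>UNIV. l $ i * r i $ k)"
          by simp
        also have "\<dots> = (\<Sum>i\<in>UNIV. if k = i then l $ i else 0)"
          by (intro sum.cong) (simp_all add: r'[OF that])
        finally show ?thesis by simp
      qed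
      moreover have "l - (\<Sum>i\<in>UNIV. l $ i *\<^sub>R r i) \<in> L"
        using that r(1) L by (intro subspace_diff subspace_sum subspace_scale) auto
      ultimately have "l - (\<Sum>i\<in>UNIV. l $ i *\<^sub>R r i) = 0"
        by (intro L_B_0) auto
      then show ?thesis by simp
    qed
  qed (use r r' in auto)
qed

text \<open>
  On the orthogonal complement \<open>M\<close> of \<open>L\<close>, the entries in \<open>B\<close> are free parameters and
  determine the entry at each \<open>i \<notin> B\<close> through the row \<open>r i\<close>.  If \<open>r i\<close> has nonzero entries at
  two places \<open>b\<close> and \<open>b'\<close> of \<open>B\<close>, then the entry at \<open>i\<close> is a genuine sum of two independent
  terms, and the signed power would have to respect the sum \<open>1 + 1\<close>.
\<close>
lemma linear_imp_two_sparse_span: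
  fixes L :: "(real ^ 'n) set"
  assumes p: "1 < p" "p \<noteq> 2" and L: "subspace L" and lin: "linear (metric_proj p L)"
  shows "\<exists>S. (\<forall>v\<in>S. card {m. v $ m \<noteq> 0} \<le> 2) \<and> L = span S"
proof -
  obtain B :: "'n set" and r where rL: "\<And>i. r i \<in> L"
    and r: "\<And>i k. k \<notin> B \<Longrightarrow> r i $ k = (if k = i then 1 else 0)"
    and rB: "\<And>i. i \<in> B \<Longrightarrow> r i = 0"
    and expand: "\<And>l. l \<in> L \<Longrightarrow> l = (\<Sum>i\<in>UNIV. l $ i *\<^sub>R r i)"
    by (rule echelon_form[OF L]) (rule that)
  define M where "M = {y. \<forall>l\<in>L. y \<bullet> l = 0}"
  have inner_r: "y \<bullet> r i = y $ i + (\<Sum>k\<in>B. y $ k * r i $ k)" if "i \<notin> B" for y i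
  proof -
    have "y \<bullet> r i = (\<Sum>k\<in>UNIV - B. y $ k * r i $ k) + (\<Sum>k\<in>B. y $ k * r i $ k)"
      unfolding inner_vec_sum by (rule sum.subset_diff) auto
    also have "(\<Sum>k\<in>UNIV - B. y $ k * r i $ k) = (\<Sum>k\<in>UNIV - B. if k = i then y $ k else 0)"
      by (intro sum.cong) (auto simp: r)
    also have "\<dots> = y $ i" using that by simp
    finally show ?thesis .
  qed
  have M_entry: "y $ i = - (\<Sum>k\<in>B. y $ k * r i $ k)" if "y \<in> M" "i \<notin> B" for y i
    using inner_r[OF that(2), of y] that(1) rL by (auto simp: M_def)
  have M_eqI: "y = z" if "y \<in> M" "z \<in> M" "\<And>k. k \<in> B \<Longrightarrow> y $ k = z $ k" for y z
  proof -
    have "y $ i = z $ i" for i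
      using that by (cases "i \<in> B") (simp_all add: M_entry)
    then show ?thesis by (simp add: vec_eq_iff)
  qed
  have M_ex: "\<exists>y\<in>M. \<forall>k\<in>B. y $ k = g k" for g :: "'n \<Rightarrow> real"
  proof
    let ?y = "\<chi> i. if i \<in> B then g i else - (\<Sum>k\<in>B. g k * r i $ k)"
    show "\<forall>k\<in>B. ?y $ k = g k" by simp
    have orth: "?y \<bullet> r i = 0" for i
      by (cases "i \<in> B") (simp_all add: rB inner_r)
    have "?y \<bullet> l = 0" if "l \<in> L" for l
    proof -
      have "?y \<bullet> l = ?y \<bullet> (\<Sum>i\<in>UNIV. l $ i *\<^sub>R r i)"
        using expand[OF that] by (rule arg_cong)
      also have "\<dots> = 0"
        by (simp only: inner_sum_right inner_scaleR_right orth) simp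
      finally show ?thesis .
    qed
    then show "?y \<in> M" by (simp add: M_def)
  qed
  let ?f = "signed_powr (p - 1)" and ?g = "signed_powr (1 / (p - 1))"
  have fg: "?f (?g t) = t" for t
    using p by (simp add: signed_powr_inverse)
  have kernel_iff: "x \<in> dual_annihilator p L \<longleftrightarrow> duality_map p x \<in> M" for x
    by (simp add: dual_annihilator_def M_def)
  have one_entry: "b = b'"
    if i: "i \<notin> B" and b: "b \<in> B" "b' \<in> B" "r i $ b \<noteq> 0" "r i $ b' \<noteq> 0" for i b b'
  proof (rule ccontr)
    assume "b \<noteq> b'"
    \<comment> \<open>The sign and the factor make the entry at \<open>i\<close> equal to \<open>1\<close>.\<close>
    have ex: "\<exists>y\<in>M. y $ i = 1 \<and> (\<forall>k\<in>B. k \<noteq> c \<longrightarrow> y $ k = 0)"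
      if c: "c \<in> B" "r i $ c \<noteq> 0" for c
    proof -
      obtain y where y: "y \<in> M" "\<And>k. k \<in> B \<Longrightarrow> y $ k = (if k = c then - 1 / r i $ c else 0)"
        using M_ex[of "\<lambda>k. if k = c then - 1 / r i $ c else 0"] by blast
      have "(\<Sum>k\<in>B. y $ k * r i $ k) = (\<Sum>k\<in>B. if k = c then - 1 else 0)"
        using c by (intro sum.cong) (auto simp: y(2))
      also have "\<dots> = - 1" using c by simp
      finally have "y $ i = 1" using M_entry[OF y(1) i] by simp
      with y show ?thesis by auto
    qed
    obtain y y' where y: "y \<in> M" "y $ i = 1" "\<And>k. k \<in> B \<Longrightarrow> k \<noteq> b \<Longrightarrow> y $ k = 0"
      and y': "y' \<in> M" "y' $ i = 1" "\<And>k. k \<in> B \<Longrightarrow> k \<noteq> b' \<Longrightarrow> y' $ k = 0"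
      using ex[OF b(1,3)] ex[OF b(2,4)] by blast
    define x where "x = (\<chi> k. ?g (y $ k))"
    define x' where "x' = (\<chi> k. ?g (y' $ k))"
    have "duality_map p x = y" "duality_map p x' = y'"
      by (simp_all add: x_def x'_def duality_map_def fg)
    with y y' have "x \<in> dual_annihilator p L" "x' \<in> dual_annihilator p L"
      by (simp_all add: kernel_iff)
    with lin have "x + x' \<in> dual_annihilator p L"
      by (simp add: linear_metric_proj_iff[OF p(1) L])
    then have "duality_map p (x + x') \<in> M" by (simp add: kernel_iff)
    moreover have "y + y' \<in> M" using y y' by (simp add: M_def inner_add_left)
    moreover have "duality_map p (x + x') $ k = (y + y') $ k" if "k \<in> B" for k
      \<comment> \<open>One of the two entries vanishes, so additivity of the signed power is not an issue.\<close>
    proof (cases "k = b")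
      case True
      then have "y' $ k = 0" using y'(3) that \<open>b \<noteq> b'\<close> by auto
      then show ?thesis by (simp add: duality_map_def x_def x'_def fg)
    next
      case False
      then have "y $ k = 0" using y(3) that by auto
      then show ?thesis by (simp add: duality_map_def x_def x'_def fg)
    qed
    ultimately have "duality_map p (x + x') = y + y'" by (rule M_eqI)
    from arg_cong[OF this, of "\<lambda>v. v $ i"] have "2 powr (p - 1) = (2 :: real)"
      using y(2) y'(2) by (simp add: duality_map_def x_def x'_def signed_powr_def)
    then have "2 powr (p - 1) = (2 :: real) powr 1" by simp
    then have "p - 1 = 1" by (subst (asm) powr_inj) auto
    with p show False by simp
  qed
  have "card {m. r i $ m \<noteq> 0} \<le> 2" for i
  proof (cases "i \<in> B")
    case False
    let ?T = "{b \<in> B. r i $ b \<noteq> 0}"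
    have "m \<in> insert i ?T" if "r i $ m \<noteq> 0" for m
      using that r[of m i] by (cases "m = i") auto
    then have "{m. r i $ m \<noteq> 0} \<subseteq> insert i ?T" by blast
    then have "card {m. r i $ m \<noteq> 0} \<le> card (insert i ?T)" by (intro card_mono) auto
    also have "\<dots> \<le> Suc (card ?T)" by (rule card_insert_le_m1) auto
    also have "card ?T \<le> Suc 0"
      using one_entry[OF False] by (subst card_le_Suc0_iff_eq) auto
    finally show ?thesis by simp
  qed (simp add: rB)
  moreover have "L = span (range r)"
  proof
    show "span (range r) \<subseteq> L" using rL L by (intro span_minimal) auto
    show "L \<subseteq> span (range r)"
    proof
      fix l assume "l \<in> L"
      have "(\<Sum>i\<in>UNIV. l $ i *\<^sub>R r i) \<in> span (range r)"
        by (rule span_sum, rule span_scale, rule span_base) simp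
      then show "l \<in> span (range r)"
        by (simp only: flip: expand[OF \<open>l \<in> L\<close>])
    qed
  qed
  ultimately show ?thesis by blast
qed

section \<open>Direct sums of lines\<close>

lemma internal_direct_sum_cong:
  assumes "\<And>k. k \<in> I \<Longrightarrow> V k = W k"
  shows "internal_direct_sum L I V \<longleftrightarrow> internal_direct_sum L I W"
proof -
  have "(\<forall>k\<in>I. v k \<in> V k) \<longleftrightarrow> (\<forall>k\<in>I. v k \<in> W k)" for v
    using assms by simp
  then show ?thesis by (simp only: internal_direct_sum_def)
qed

lemma internal_direct_sum_lines_of_basis:
  fixes h :: "'k \<Rightarrow> 'a::real_vector"
  assumes I: "finite I" and inj: "inj_on h I" and ind: "independent (h ` I)"
  shows "internal_direct_sum (span (h ` I)) I (\<lambda>k. span {h k})"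
  unfolding internal_direct_sum_def
proof (intro conjI allI impI set_eqI iffI)
  fix x assume "x \<in> span (h ` I)"
  then obtain u where u: "x = (\<Sum>v\<in>h ` I. u v *\<^sub>R v)"
    using I by (auto simp: span_finite)
  then have "x = (\<Sum>k\<in>I. u (h k) *\<^sub>R h k)"
    using inj by (simp add: sum.reindex)
  moreover have "\<forall>k\<in>I. u (h k) *\<^sub>R h k \<in> span {h k}"
    by (auto intro: span_scale span_base)
  ultimately show "x \<in> {\<Sum>k\<in>I. v k |v. \<forall>k\<in>I. v k \<in> span {h k}}"
    by (intro CollectI exI[of _ "\<lambda>k. u (h k) *\<^sub>R h k"]) simp
next
  fix x assume "x \<in> {\<Sum>k\<in>I. v k |v. \<forall>k\<in>I. v k \<in> span {h k}}"
  then show "x \<in> span (h ` I)"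
    by (auto intro!: span_sum) (meson empty_subsetI image_eqI insert_subset span_mono subsetD)
next
  fix v assume v: "(\<forall>k\<in>I. v k \<in> span {h k}) \<and> (\<Sum>k\<in>I. v k) = 0"
  then have "\<forall>k\<in>I. \<exists>c. v k = c *\<^sub>R h k" by (auto simp: span_singleton)
  then obtain c where c: "\<And>k. k \<in> I \<Longrightarrow> v k = c k *\<^sub>R h k" by metis
  let ?u = "\<lambda>x. c (the_inv_into I h x)"
  have "(\<Sum>x\<in>h ` I. ?u x *\<^sub>R x) = (\<Sum>k\<in>I. v k)"
    using inj by (simp add: sum.reindex the_inv_into_f_f c)
  with v have "(\<Sum>x\<in>h ` I. ?u x *\<^sub>R x) = 0" by simp
  then have "?u (h k) = 0" if "k \<in> I" for k
    using ind I that by (intro independentD[of "h ` I" "h ` I"]) auto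
  with c inj show "\<forall>k\<in>I. v k = 0" by (simp add: the_inv_into_f_f)
qed

lemma internal_direct_sum_lines_span:
  fixes w :: "'k \<Rightarrow> 'a::real_vector"
  assumes I: "finite I" and L: "subspace L"
    and sum: "internal_direct_sum L I (\<lambda>k. span {w k})"
  shows "L = span (w ` I)"
proof
  have L_eq: "L = {\<Sum>k\<in>I. v k |v. \<forall>k\<in>I. v k \<in> span {w k}}"
    using sum by (simp add: internal_direct_sum_def)
  show "L \<subseteq> span (w ` I)"
    unfolding L_eq
    by (auto intro!: span_sum) (meson empty_subsetI image_eqI insert_subset span_mono subsetD)
  have "w k \<in> L" if "k \<in> I" for k
    unfolding L_eq using that I
    by (intro CollectI exI[of _ "\<lambda>m. if m = k then w k else 0"])
       (auto intro: span_base span_zero)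
  then show "span (w ` I) \<subseteq> L" using L by (intro span_minimal) auto
qed

lemma two_sparse_line:
  fixes v :: "real ^ 'n"
  assumes "v \<noteq> 0" and "card {m. v $ m \<noteq> 0} \<le> 2"
  shows "\<exists>i j l. span {v} = span {axis i 1 + l *\<^sub>R axis j 1}"
proof -
  have *: "\<exists>i j l. span {v} = span {axis i 1 + l *\<^sub>R axis j 1}"
    if "v = a *\<^sub>R axis i 1 + b *\<^sub>R axis j 1" "a \<noteq> 0" for a b i j
  proof -
    let ?w = "axis i 1 + (b / a) *\<^sub>R axis j 1 :: real ^ 'n"
    have "v = a *\<^sub>R ?w" using that by (simp add: algebra_simps)
    then have "span {v} = span {?w}"
      using span_image_scale[of "{?w}" "\<lambda>_. a"] \<open>a \<noteq> 0\<close> by simp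
    then show ?thesis by blast
  qed
  obtain i j a b where v: "v = a *\<^sub>R axis i 1 + b *\<^sub>R axis j 1"
    using two_sparse_decompose[OF assms(2)] .
  show ?thesis
  proof (cases "a = 0")
    case True
    with v assms(1) have "v = b *\<^sub>R axis j 1 + a *\<^sub>R axis i 1" "b \<noteq> 0" by auto
    then show ?thesis by (rule *)
  qed (use * v in blast)
qed

lemma card_support_axis_add_axis:
  "card {m. (axis i 1 + l *\<^sub>R axis j 1 :: real ^ 'n) $ m \<noteq> 0} \<le> 2"
proof -
  have "{m. (axis i 1 + l *\<^sub>R axis j 1 :: real ^ 'n) $ m \<noteq> 0} \<subseteq> {i, j}"
    by (auto simp: axis_def split: if_splits)
  then have "card {m. (axis i 1 + l *\<^sub>R axis j 1 :: real ^ 'n) $ m \<noteq> 0} \<le> card {i, j}"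
    by (intro card_mono) auto
  also have "\<dots> \<le> 2" by (simp add: card_insert_if)
  finally show ?thesis .
qed

lemma two_sparse_span_iff_direct_sum:
  fixes L :: "(real ^ 'n) set"
  assumes L: "subspace L" and nonzero: "L \<noteq> {0}"
  shows "(\<exists>S. (\<forall>v\<in>S. card {m. v $ m \<noteq> 0} \<le> 2) \<and> L = span S) \<longleftrightarrow>
    (\<exists>d\<in>{1..CARD('n)}. \<exists>(i :: nat \<Rightarrow> 'n) (j :: nat \<Rightarrow> 'n) (l :: nat \<Rightarrow> real).
       internal_direct_sum L {1..d} (\<lambda>k. span {axis (i k) 1 + l k *\<^sub>R axis (j k) 1}))"
    (is "?sparse \<longleftrightarrow> ?direct")
proof
  assume ?sparse
  then obtain S where S: "\<And>v. v \<in> S \<Longrightarrow> card {m. v $ m \<noteq> 0} \<le> 2" "L = span S" by blast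
  obtain B where B: "B \<subseteq> S" "independent B" "S \<subseteq> span B"
    using maximal_independent_subset[of S] by blast
  have LB: "L = span B"
    using B S(2) span_eq[of S B] span_superset[of S] by auto
  have fin: "finite B" using B independent_imp_finite by blast
  obtain h where h: "bij_betw h {1..card B} B"
    using ex_bij_betw_nat_finite_1[OF fin] by blast
  have "B \<noteq> {}" using LB nonzero by auto
  then have "card B \<in> {1..CARD('n)}"
    using B fin independent_bound[of B] by (auto simp: Suc_le_eq card_gt_0_iff)
  moreover have "\<exists>i j l. span {h k} = span {axis i 1 + l *\<^sub>R axis j 1}" if "k \<in> {1..card B}" for k
  proof -
    have "h k \<in> B" using h that by (auto simp: bij_betw_def)
    moreover from this have "h k \<noteq> 0" using B dependent_zero by metis
    ultimately show ?thesis using S B by (intro two_sparse_line) auto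
  qed
  then obtain i j l where ijl:
    "\<And>k. k \<in> {1..card B} \<Longrightarrow> span {h k} = span {axis (i k) 1 + l k *\<^sub>R axis (j k) 1}"
    by metis
  have hB: "h ` {1..card B} = B" "inj_on h {1..card B}" using h by (auto simp: bij_betw_def)
  then have "internal_direct_sum (span (h ` {1..card B})) {1..card B} (\<lambda>k. span {h k})"
    using B by (intro internal_direct_sum_lines_of_basis) auto
  then have "internal_direct_sum L {1..card B} (\<lambda>k. span {h k})"
    by (simp only: LB hB(1))
  then have "internal_direct_sum L {1..card B}
      (\<lambda>k. span {axis (i k) 1 + l k *\<^sub>R axis (j k) 1})"
    by (rule iffD1[OF internal_direct_sum_cong, rotated]) (erule ijl)
  ultimately show ?direct
    by (intro bexI[of _ "card B"] exI[of _ i] exI[of _ j] exI[of _ l])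
next
  assume ?direct
  then obtain d and i j :: "nat \<Rightarrow> 'n" and l where
    "internal_direct_sum L {1..d} (\<lambda>k. span {axis (i k) 1 + l k *\<^sub>R axis (j k) 1})" by blast
  then have "L = span ((\<lambda>k. axis (i k) 1 + l k *\<^sub>R axis (j k) 1) ` {1..d})" (is "_ = span (?w ` _)")
    using L by (intro internal_direct_sum_lines_span) auto
  moreover have "\<forall>v\<in>?w ` {1..d}. card {m. v $ m \<noteq> 0} \<le> 2"
    by (intro ballI) (elim imageE, hypsubst, rule card_support_axis_add_axis)
  ultimately show ?sparse by (intro exI conjI)
qed

theorem theorem3p5:
  fixes p :: real and L :: "(real ^ 'n) set"
  assumes "1 < p" and "p \<noteq> 2"
    and "CARD('n) \<ge> 2"
    and "subspace L" and "L \<noteq> {0}"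
  shows "(linear (metric_proj p L) \<longleftrightarrow>
            (\<exists>d\<in>{1..CARD('n)}. \<exists>(i :: nat \<Rightarrow> 'n) (j :: nat \<Rightarrow> 'n) (l :: nat \<Rightarrow> real).
               internal_direct_sum L {1..d}
                 (\<lambda>k. span {axis (i k) 1 + l k *\<^sub>R axis (j k) 1}))) \<and>
         (linear (metric_proj p L) \<longleftrightarrow>
            (\<exists>S. (\<forall>v\<in>S. card {m. v $ m \<noteq> 0} \<le> 2) \<and> L = span S))"
proof -
  have "linear (metric_proj p L) \<longleftrightarrow>
      (\<exists>S. (\<forall>v\<in>S. card {m. v $ m \<noteq> 0} \<le> 2) \<and> L = span S)"
    using linear_imp_two_sparse_span[OF assms(1,2,4)] two_sparse_span_imp_linear[OF assms(1)]
    by blast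
  then show ?thesis
    using two_sparse_span_iff_direct_sum[OF assms(4,5)] by blast
qed

end
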